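(* Let $g\geq 2$ be an integer and let $a,a'\in\mathbb{N}$. Then $$\lim_{N\to\infty}\frac{|\{n\leq N:\ n\equiv b \pmod a,\ S_g(n)\equiv b' \pmod{a'}\}|}{N}=\frac{1}{aa'}$$ for every $(b,b')\in\mathbb{Z}/a\mathbb{Z}\times\mathbb{Z}/a'\mathbb{Z}$ if and only if there exists $n\in\mathbb{N}$ such that $n\equiv 0\pmod a$ and $S_g(n)\equiv 1\pmod{a'}$.
   Context: $\mathbb{N}=\{1,2,\dots\}$; in the counting set, $n$ ranges over positive integers. $S_g(n)$ denotes the sum of the digits of $n$ in base $g$: $S_g(\sum_{i=0}^m w_ig^i)=w_0+\dots+w_m$ for $w_i\in\{0,\dots,g-1\}$. *)

theory Defs
  imports Complex_Main "HOL-Number_Theory.Cong"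
begin

(* The value is described through an arbitrary base-g expansion (leading zeros are allowed).
   For g >= 2 such an expansion exists and the sum of its digits depends only on n: see
   digit_sum_expansion and digit_sum_rec below. *)
definition digit_sum :: "nat \<Rightarrow> nat \<Rightarrow> nat" where
  "digit_sum g n =
     (THE s. \<exists>m w. (\<forall>i\<le>m. w i < g) \<and> n = (\<Sum>i\<le>m. w i * g ^ i) \<and> s = (\<Sum>i\<le>m. w i))"

lemma expansion_shift:
  fixes g :: nat
  shows "(\<Sum>i\<le>Suc m. w i * g ^ i) = w 0 + g * (\<Sum>i\<le>m. w (Suc i) * g ^ i)"
  by (subst sum.atMost_Suc_shift) (simp add: sum_distrib_left algebra_simps)

lemma expansion_sum_unique:
  fixes g :: nat
  assumes "g \<ge> 2"
    and "\<forall>i\<le>m. w i < g" and "\<forall>i\<le>m'. w' i < g"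
    and "(\<Sum>i\<le>m. w i * g ^ i) = (\<Sum>i\<le>m'. w' i * g ^ i)"
  shows "(\<Sum>i\<le>m. w i) = (\<Sum>i\<le>m'. w' i)"
proof -
  have pad: "\<exists>v. (\<forall>i\<le>m + k. v i < g) \<and> (\<Sum>i\<le>m + k. v i * g ^ i) = (\<Sum>i\<le>m. u i * g ^ i)
      \<and> (\<Sum>i\<le>m + k. v i) = (\<Sum>i\<le>m. u i)"
    if "\<forall>i\<le>m. u i < g" for u :: "nat \<Rightarrow> nat" and m k
  proof (intro exI conjI)
    let ?v = "\<lambda>i. if i \<le> m then u i else 0"
    show "\<forall>i\<le>m + k. ?v i < g" using that assms(1) by auto
    show "(\<Sum>i\<le>m + k. ?v i * g ^ i) = (\<Sum>i\<le>m. u i * g ^ i)"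
      by (rule sum.mono_neutral_cong_right) auto
    show "(\<Sum>i\<le>m + k. ?v i) = (\<Sum>i\<le>m. u i)"
      by (rule sum.mono_neutral_cong_right) auto
  qed
  have same: "(\<Sum>i\<le>m. u i) = (\<Sum>i\<le>m. v i)"
    if "\<forall>i\<le>m. u i < g" "\<forall>i\<le>m. v i < g" "(\<Sum>i\<le>m. u i * g ^ i) = (\<Sum>i\<le>m. v i * g ^ i)"
    for u v :: "nat \<Rightarrow> nat" and m
    using that
  proof (induction m arbitrary: u v)
    case 0
    then show ?case by simp
  next
    case (Suc m)
    define x y where "x = (\<Sum>i\<le>m. u (Suc i) * g ^ i)" and "y = (\<Sum>i\<le>m. v (Suc i) * g ^ i)"
    have eq: "u 0 + g * x = v 0 + g * y"
      using Suc.prems(3) unfolding expansion_shift x_def y_def .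
    have "u 0 < g" "v 0 < g" using Suc.prems by auto
    then have u0: "u 0 = v 0" using arg_cong[OF eq, of "\<lambda>t. t mod g"] by simp
    then have "x = y" using eq assms(1) by simp
    then have "(\<Sum>i\<le>m. u (Suc i) * g ^ i) = (\<Sum>i\<le>m. v (Suc i) * g ^ i)"
      by (simp only: x_def y_def)
    moreover have "\<forall>i\<le>m. u (Suc i) < g" "\<forall>i\<le>m. v (Suc i) < g"
      using Suc.prems(1,2) by simp_all
    ultimately have "(\<Sum>i\<le>m. u (Suc i)) = (\<Sum>i\<le>m. v (Suc i))"
      by (rule Suc.IH[rotated 2])
    then show ?case using u0 by (simp only: sum.atMost_Suc_shift)
  qed
  obtain v where v: "\<forall>i\<le>m + m'. v i < g" "(\<Sum>i\<le>m + m'. v i * g ^ i) = (\<Sum>i\<le>m. w i * g ^ i)"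
    "(\<Sum>i\<le>m + m'. v i) = (\<Sum>i\<le>m. w i)"
    using pad[OF assms(2)] by blast
  obtain v' where v': "\<forall>i\<le>m' + m. v' i < g"
    "(\<Sum>i\<le>m' + m. v' i * g ^ i) = (\<Sum>i\<le>m'. w' i * g ^ i)"
    "(\<Sum>i\<le>m' + m. v' i) = (\<Sum>i\<le>m'. w' i)"
    using pad[OF assms(3)] by blast
  have "(\<Sum>i\<le>m + m'. v i * g ^ i) = (\<Sum>i\<le>m + m'. v' i * g ^ i)"
    using v(2) v'(2) assms(4) by (metis add.commute)
  moreover have "\<forall>i\<le>m + m'. v' i < g"
    using v'(1) by (metis add.commute)
  ultimately have "(\<Sum>i\<le>m + m'. v i) = (\<Sum>i\<le>m + m'. v' i)"
    using same v(1) by blast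
  then show ?thesis using v(3) v'(3) by (metis add.commute)
qed

lemma digit_sum_expansion:
  fixes g :: nat
  assumes "g \<ge> 2" and "\<forall>i\<le>m. w i < g"
  shows "digit_sum g (\<Sum>i\<le>m. w i * g ^ i) = (\<Sum>i\<le>m. w i)"
  unfolding digit_sum_def
proof (rule the_equality)
  fix s
  assume "\<exists>m' w'. (\<forall>i\<le>m'. w' i < g) \<and> (\<Sum>i\<le>m. w i * g ^ i) = (\<Sum>i\<le>m'. w' i * g ^ i)
    \<and> s = (\<Sum>i\<le>m'. w' i)"
  then show "s = (\<Sum>i\<le>m. w i)"
    using expansion_sum_unique[OF assms] by metis
qed (use assms in blast)

lemma expansion_exists:
  fixes g :: nat
  assumes "g \<ge> 2"
  shows "\<exists>m w. (\<forall>i\<le>m. w i < g) \<and> n = (\<Sum>i\<le>m. w i * g ^ i)"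
proof (induction n rule: less_induct)
  case (less n)
  show ?case
  proof (cases "n < g")
    case True
    then show ?thesis by (intro exI[of _ 0] exI[of _ "\<lambda>_. n"]) simp
  next
    case False
    then have "n div g < n" using assms by simp
    then obtain m w where mw: "\<forall>i\<le>m. w i < g" "n div g = (\<Sum>i\<le>m. w i * g ^ i)"
      using less by blast
    let ?w = "\<lambda>i. case i of 0 \<Rightarrow> n mod g | Suc j \<Rightarrow> w j"
    have "\<forall>i\<le>Suc m. ?w i < g"
      using mw(1) assms by (auto split: nat.split)
    moreover have "n = (\<Sum>i\<le>Suc m. ?w i * g ^ i)"
      unfolding expansion_shift by (simp flip: mw(2))
    ultimately show ?thesis by blast
  qed
qed

lemma digit_sum_less:
  assumes "g \<ge> 2" and "n < g"
  shows "digit_sum g n = n"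
  using digit_sum_expansion[of g 0 "\<lambda>_. n"] assms by simp

lemma digit_sum_rec:
  assumes "g \<ge> 2"
  shows "digit_sum g n = n mod g + digit_sum g (n div g)"
proof -
  obtain m w where mw: "\<forall>i\<le>m. w i < g" "n div g = (\<Sum>i\<le>m. w i * g ^ i)"
    using expansion_exists[OF assms] by blast
  let ?w = "\<lambda>i. case i of 0 \<Rightarrow> n mod g | Suc j \<Rightarrow> w j"
  have lt: "\<forall>i\<le>Suc m. ?w i < g"
    using mw(1) assms by (auto split: nat.split)
  have "n = (\<Sum>i\<le>Suc m. ?w i * g ^ i)"
    unfolding expansion_shift by (simp flip: mw(2))
  then have "digit_sum g n = (\<Sum>i\<le>Suc m. ?w i)"
    using digit_sum_expansion[OF assms lt] by simp
  also have "\<dots> = n mod g + (\<Sum>i\<le>m. w i)"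
    by (simp only: sum.atMost_Suc_shift nat.case)
  also have "(\<Sum>i\<le>m. w i) = digit_sum g (n div g)"
    using digit_sum_expansion[OF assms mw(1)] mw(2) by simp
  finally show ?thesis .
qed

end

theory Submission
  imports Defs
begin

text \<open>
  By orthogonality of characters it suffices that the averages of
  \<open>\<alpha> ^ n * \<beta> ^ S\<^sub>g(n)\<close> tend to 0 for all roots of unity with \<open>\<alpha> ^ a = 1\<close>, \<open>\<beta> ^ a' = 1\<close>, not both 1.
  The sum over \<open>n < g ^ L\<close> factors over the digit positions \<open>i < L\<close> into geometric sums of
  \<open>z\<^sub>i = \<alpha> ^ (g ^ i) * \<beta>\<close>, and its normalised modulus bounds the averages asymptotically.
  Only finitely many values \<open>z\<^sub>i\<close> occur, so the normalised product tends to 0 if \<open>z\<^sub>i \<noteq> 1\<close> for infinitely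
  many \<open>i\<close>. If \<open>z\<^sub>i = 1\<close> for all \<open>i \<ge> M\<close>, then the character is 1 at \<open>g ^ M * n\<close> for all \<open>n\<close>;
  an \<open>n\<close> with \<open>a\<close> dividing \<open>n\<close> and \<open>S\<^sub>g(n) \<equiv> 1\<close> gives \<open>\<beta> = 1\<close>, and then the factor at the last position \<open>i\<close>
  with \<open>\<alpha> ^ (g ^ i) \<noteq> 1\<close> vanishes.
\<close>

section \<open>Digit sums and their characters when a block of low digits is split off\<close>

lemma digit_sum_add_power_mult:
  assumes "g \<ge> 2" and "m < g ^ L"
  shows "digit_sum g (m + g ^ L * q) = digit_sum g m + digit_sum g q"
  using assms(2)
proof (induction L arbitrary: m)
  case 0
  then show ?case using digit_sum_less[of g 0] assms(1) by simp
next
  case (Suc L)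
  have "m div g < g ^ L"
    using Suc.prems by (simp add: less_mult_imp_div_less mult.commute)
  moreover have "(m + g ^ Suc L * q) mod g = m mod g"
    by (simp add: mult.assoc)
  moreover have "(m + g ^ Suc L * q) div g = m div g + g ^ L * q"
    using assms(1) by (simp add: mult.assoc)
  ultimately show ?case
    using Suc.IH digit_sum_rec[OF assms(1), of m] digit_sum_rec[OF assms(1), of "m + g ^ Suc L * q"]
    by simp
qed

text \<open>This function is multiplicative only across blocks of digits. Splitting off
  \<open>L\<close> low digits turns \<alpha> into \<open>\<alpha> ^ (g ^ L)\<close>, so \<alpha>
  stays a parameter.\<close>

definition digit_char :: "nat \<Rightarrow> complex \<Rightarrow> complex \<Rightarrow> nat \<Rightarrow> complex" where
  "digit_char g \<alpha> \<beta> n = \<alpha> ^ n * \<beta> ^ digit_sum g n"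

lemma digit_char_less:
  assumes "g \<ge> 2" and "n < g"
  shows "digit_char g \<alpha> \<beta> n = (\<alpha> * \<beta>) ^ n"
  using digit_sum_less[OF assms] by (simp add: digit_char_def power_mult_distrib)

lemma digit_char_add_power_mult:
  assumes "g \<ge> 2" and "m < g ^ L"
  shows "digit_char g \<alpha> \<beta> (m + g ^ L * q) = digit_char g \<alpha> \<beta> m * digit_char g (\<alpha> ^ (g ^ L)) \<beta> q"
  by (simp add: digit_char_def digit_sum_add_power_mult[OF assms] power_add power_mult)

lemma norm_digit_char:
  assumes "norm \<alpha> = 1" and "norm \<beta> = 1"
  shows "norm (digit_char g \<alpha> \<beta> n) = 1"
  using assms by (simp add: digit_char_def norm_mult norm_power)

text \<open>A digit \<open>d\<close> at position \<open>i\<close> contributes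
  \<open>(\<gamma> ^ (g ^ i) * \<beta>) ^ d\<close>, so every contribution is 1. Removing the lowest
  digit replaces \<open>\<gamma>\<close> by \<open>\<gamma> ^ g\<close> and shifts the hypothesis by
  one position, hence the induction over arbitrary \<open>\<gamma>\<close>.\<close>

lemma digit_char_eq_1:
  assumes "g \<ge> 2" and "\<And>i. \<gamma> ^ (g ^ i) * \<beta> = 1"
  shows "digit_char g \<gamma> \<beta> n = 1"
  using assms(2)
proof (induction n arbitrary: \<gamma> rule: less_induct)
  case (less n)
  have eq1: "\<gamma> * \<beta> = 1" using less.prems[of 0] by simp
  show ?case
  proof (cases "n < g")
    case True
    then show ?thesis using eq1 by (simp add: digit_char_less[OF assms(1)])
  next
    case False
    have "(\<gamma> ^ g) ^ (g ^ i) * \<beta> = 1" for i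
      using less.prems[of "Suc i"] by (simp add: power_mult)
    then have "digit_char g (\<gamma> ^ g) \<beta> (n div g) = 1"
      using False assms(1) by (intro less.IH) auto
    moreover have "n mod g < g" using assms(1) by simp
    ultimately show ?thesis
      using digit_char_add_power_mult[OF assms(1), of "n mod g" 1 \<gamma> \<beta> "n div g"] eq1
      by (simp add: digit_char_less[OF assms(1)])
  qed
qed

section \<open>Sums over blocks of \<open>g ^ L\<close> consecutive integers\<close>

lemma sum_lessThan_blocks:
  fixes F :: "nat \<Rightarrow> 'a::comm_monoid_add"
  shows "(\<Sum>n<q * k. F n) = (\<Sum>j<q. \<Sum>m<k. F (m + k * j))"
proof -
  have "sum F {j * k..<j * k + k} = (\<Sum>m<k. F (m + k * j))" for j
    using sum.shift_bounds_nat_ivl[of F 0 "j * k" k]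
    by (simp add: add.commute mult.commute lessThan_atLeast0)
  then show ?thesis by (simp flip: sum.nat_group)
qed

lemma sum_digit_char_block:
  assumes "g \<ge> 2"
  shows "(\<Sum>m<g ^ L. digit_char g \<alpha> \<beta> (m + g ^ L * q)) =
    (\<Sum>m<g ^ L. digit_char g \<alpha> \<beta> m) * digit_char g (\<alpha> ^ (g ^ L)) \<beta> q"
  by (simp add: digit_char_add_power_mult[OF assms] sum_distrib_right)

text \<open>The top digit \<open>d\<close> varies independently of the \<open>L\<close> lower ones
  and contributes \<open>(\<alpha> ^ (g ^ L) * \<beta>) ^ d\<close>. Iteration yields the product
  over all digit positions.\<close>

lemma sum_digit_char_power_Suc:
  assumes "g \<ge> 2"
  shows "(\<Sum>n<g ^ Suc L. digit_char g \<alpha> \<beta> n) =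
    (\<Sum>n<g ^ L. digit_char g \<alpha> \<beta> n) * (\<Sum>d<g. (\<alpha> ^ (g ^ L) * \<beta>) ^ d)"
  by (simp add: sum_lessThan_blocks sum_digit_char_block[OF assms] digit_char_less[OF assms]
      flip: sum_distrib_left)

text \<open>Within a full block the upper digits are fixed, so its sum is that of the first block
  times a number of modulus 1. The incomplete last block is bounded trivially by its length.\<close>

lemma norm_sum_digit_char_le:
  assumes "g \<ge> 2" and "norm \<alpha> = 1" and "norm \<beta> = 1"
    and "norm (\<Sum>n<g ^ L. digit_char g \<alpha> \<beta> n) \<le> \<epsilon> * real (g ^ L)" and "\<epsilon> \<ge> 0"
  shows "norm (\<Sum>n<N. digit_char g \<alpha> \<beta> n) \<le> \<epsilon> * real N + real (g ^ L)"
proof -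
  let ?f = "digit_char g \<alpha> \<beta>"
  define k q where "k = g ^ L" and "q = N div k"
  have k: "k > 0" using assms(1) by (simp add: k_def)
  have le: "q * k \<le> N" by (simp add: q_def)
  have split: "{..<N} = {..<q * k} \<union> {q * k..<N}" using le by auto
  have "(\<Sum>n<N. ?f n) = (\<Sum>n<q * k. ?f n) + (\<Sum>n=q * k..<N. ?f n)"
    unfolding split by (rule sum.union_disjoint) auto
  moreover have "norm (\<Sum>n<q * k. ?f n) \<le> \<epsilon> * real N"
  proof -
    have "norm (\<Sum>n<q * k. ?f n) \<le> (\<Sum>j<q. norm (\<Sum>m<k. ?f (m + k * j)))"
      unfolding sum_lessThan_blocks by (rule norm_sum)
    also have "\<dots> \<le> (\<Sum>j<q. \<epsilon> * real k)"
    proof (rule sum_mono)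
      fix j
      have "norm (digit_char g (\<alpha> ^ k) \<beta> j) = 1"
        by (rule norm_digit_char) (simp_all add: assms norm_power)
      then show "norm (\<Sum>m<k. ?f (m + k * j)) \<le> \<epsilon> * real k"
        using assms(4) by (simp add: k_def sum_digit_char_block[OF assms(1)] norm_mult)
    qed
    also have "\<dots> = \<epsilon> * real (q * k)" by simp
    also have "\<dots> \<le> \<epsilon> * real N" using le assms(5) by (intro mult_left_mono) linarith+
    finally show ?thesis .
  qed
  moreover have "norm (\<Sum>n=q * k..<N. ?f n) \<le> real k"
  proof -
    have "norm (\<Sum>n=q * k..<N. ?f n) \<le> (\<Sum>n=q * k..<N. norm (?f n))" by (rule norm_sum)
    also have "\<dots> = real (N - q * k)" by (simp add: norm_digit_char assms)
    also have "N - q * k = N mod k" by (simp add: q_def minus_div_mult_eq_mod)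
    also have "real (N mod k) \<le> real k" using k by (simp add: less_imp_le)
    finally show ?thesis .
  qed
  ultimately show ?thesis
    unfolding k_def by (metis add_mono norm_triangle_mono)
qed

section \<open>Decay of the normalised block sums\<close>

lemma norm_geometric_sum_less:
  fixes z :: complex
  assumes "g \<ge> 2" and "norm z = 1" and "z \<noteq> 1"
  shows "norm (\<Sum>d<g. z ^ d) < real g"
proof -
  \<comment> \<open>Strictness comes from the first two terms alone: \<open>Re z < 1\<close> gives
    \<open>norm (1 + z) < 2\<close>, and the other \<open>g - 2\<close> terms have modulus
    1.\<close>
  have "Re z < 1"
  proof (rule ccontr)
    assume "\<not> Re z < 1"
    then have "Re z = 1" using complex_Re_le_cmod[of z] assms(2) by simp
    then have "Im z = 0" using assms(2) cmod_power2[of z] by simp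
    with \<open>Re z = 1\<close> assms(3) show False by (simp add: complex_eq_iff)
  qed
  moreover have "(Re z)\<^sup>2 + (Im z)\<^sup>2 = 1" using assms(2) cmod_power2[of z] by simp
  moreover have "(norm (1 + z))\<^sup>2 = 1 + 2 * Re z + ((Re z)\<^sup>2 + (Im z)\<^sup>2)"
    unfolding cmod_power2 by (simp add: power2_eq_square algebra_simps)
  ultimately have "(norm (1 + z))\<^sup>2 < 2\<^sup>2" by simp
  then have lt: "norm (1 + z) < 2" by (rule power_less_imp_less_base) simp
  obtain h where h: "g = Suc (Suc h)" using assms(1) by (metis Suc_le_D numeral_2_eq_2 Suc_le_mono)
  have split: "(\<Sum>d<g. z ^ d) = (1 + z) + (\<Sum>d<h. z ^ Suc (Suc d))"
    by (simp only: h sum.lessThan_Suc_shift) simp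
  have "norm (\<Sum>d<h. z ^ Suc (Suc d)) \<le> (\<Sum>d<h. norm (z ^ Suc (Suc d)))"
    by (rule norm_sum)
  moreover have "(\<Sum>d<h. norm (z ^ Suc (Suc d))) = real h"
    using assms(2) by (simp add: norm_power norm_mult)
  ultimately have "norm (\<Sum>d<g. z ^ d) < 2 + real h"
    unfolding split using lt norm_triangle_ineq[of "1 + z" "\<Sum>d<h. z ^ Suc (Suc d)"] by linarith
  then show ?thesis by (simp add: h)
qed

lemma norm_root_unity:
  fixes z :: complex
  assumes "z ^ a = 1" and "a \<ge> 1"
  shows "norm z = 1"
  using assms by (metis norm_ge_zero norm_one norm_power not_one_le_zero power_eq_1_iff zero_less_one gr0I)

lemma power_cong_root_unity:
  fixes z :: "'a::monoid_mult"
  assumes "z ^ m = 1" and "[i = j] (mod m)"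
  shows "z ^ i = z ^ j"
proof -
  have "z ^ n = z ^ (n mod m)" for n
    by (metis assms(1) div_mult_mod_eq mult.commute mult_1 power_add power_mult power_one)
  then show ?thesis using assms(2) unfolding cong_def by metis
qed

text \<open>The factors other than \<open>z = 1\<close> come from finitely many roots of unity, so a
  single ratio \<open>\<rho> < 1\<close> bounds them all. Each nontrivial position gains a factor
  \<open>\<rho>\<close>, and the trivial ones lose nothing.\<close>

lemma small_block_sum_if_frequently_nontrivial:
  assumes "g \<ge> 2" and "a \<ge> 1" and "a' \<ge> 1" and "\<alpha> ^ a = 1" and "\<beta> ^ a' = 1"
    and inf: "\<And>M. \<exists>i\<ge>M. \<alpha> ^ (g ^ i) * \<beta> \<noteq> 1" and "\<epsilon> > 0"
  shows "\<exists>L. norm (\<Sum>n<g ^ L. digit_char g \<alpha> \<beta> n) \<le> \<epsilon> * real (g ^ L)"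
proof -
  let ?P = "\<lambda>L. \<Sum>n<g ^ L. digit_char g \<alpha> \<beta> n"
  define Z where "Z = {z::complex. z ^ (a * a') = 1} - {1}"
  define r where "r z = norm (\<Sum>d<g. z ^ d) / real g" for z :: complex
  \<comment> \<open>The inserted 0 makes the maximum meaningful for empty \<open>Z\<close> and gives
    \<open>0 \<le> \<rho>\<close>.\<close>
  define \<rho> where "\<rho> = Max (insert 0 (r ` Z))"
  have z: "(\<alpha> ^ (g ^ i) * \<beta>) ^ (a * a') = 1" for i
  proof -
    have "(\<alpha> ^ (g ^ i) * \<beta>) ^ (a * a') = (\<alpha> ^ a) ^ (g ^ i * a') * (\<beta> ^ a') ^ a"
      unfolding power_mult_distrib by (simp only: mult_ac flip: power_mult)
    then show ?thesis by (simp add: assms(4,5))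
  qed
  have fin: "finite (insert 0 (r ` Z))"
    unfolding Z_def using assms(2,3) by (simp add: finite_roots_unity)
  have \<rho>: "0 \<le> \<rho>" "\<And>z. z \<in> Z \<Longrightarrow> r z \<le> \<rho>"
    unfolding \<rho>_def using fin by (auto intro: Max_ge)
  have "r z < 1" if "z \<in> Z" for z
  proof -
    have "norm z = 1" using that assms(2,3) norm_root_unity[of z "a * a'"] by (simp add: Z_def)
    then show ?thesis using that norm_geometric_sum_less[OF assms(1)] assms(1) by (simp add: r_def Z_def)
  qed
  then have \<rho>1: "\<rho> < 1" unfolding \<rho>_def using fin by auto
  have extend: "norm (?P (Suc L)) \<le> norm (?P L) * real g" for L
  proof -
    have "norm (\<alpha> ^ (g ^ L) * \<beta>) = 1"
      using z[of L] norm_root_unity[of _ "a * a'"] assms(2,3) by simp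
    then have "norm (\<Sum>d<g. (\<alpha> ^ (g ^ L) * \<beta>) ^ d) \<le> real g"
      using sum_norm_le[of "{..<g}" "\<lambda>d. (\<alpha> ^ (g ^ L) * \<beta>) ^ d" "\<lambda>_. 1"] by (simp add: norm_power)
    then show ?thesis
      unfolding sum_digit_char_power_Suc[OF assms(1)] norm_mult by (simp add: mult_left_mono)
  qed
  \<comment> \<open>A relative bound reached at length \<open>L\<close> persists up to the next
    nontrivial position.\<close>
  have later: "norm (?P j) \<le> c * real (g ^ j)"
    if "L \<le> j" "norm (?P L) \<le> c * real (g ^ L)" for L j c
    using that(1)
  proof (induction j rule: dec_induct)
    case base
    show ?case by (rule that(2))
  next
    case (step j)
    have "norm (?P (Suc j)) \<le> norm (?P j) * real g" by (rule extend)
    also have "\<dots> \<le> (c * real (g ^ j)) * real g" using step.IH by (rule mult_right_mono) simp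
    finally show ?case by (simp add: mult_ac)
  qed
  \<comment> \<open>Here \<open>k\<close> counts the nontrivial positions exploited so far.\<close>
  have "\<exists>L. norm (?P L) \<le> \<rho> ^ k * real (g ^ L)" for k
  proof (induction k)
    case 0
    show ?case using digit_char_less[OF assms(1), of 0] assms(1) by (intro exI[of _ 0]) simp
  next
    case (Suc k)
    then obtain L where L: "norm (?P L) \<le> \<rho> ^ k * real (g ^ L)" by blast
    obtain i where i: "i \<ge> L" "\<alpha> ^ (g ^ i) * \<beta> \<noteq> 1" using inf by blast
    then have "r (\<alpha> ^ (g ^ i) * \<beta>) \<le> \<rho>" using z by (intro \<rho>(2)) (simp add: Z_def)
    then have Q: "norm (\<Sum>d<g. (\<alpha> ^ (g ^ i) * \<beta>) ^ d) \<le> \<rho> * real g"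
      using assms(1) by (simp add: r_def field_simps)
    have "norm (?P (Suc i)) \<le> (\<rho> ^ k * real (g ^ i)) * (\<rho> * real g)"
      unfolding sum_digit_char_power_Suc[OF assms(1)] norm_mult
      using later[OF i(1) L] Q \<rho>(1) by (intro mult_mono) simp_all
    then show ?case by (intro exI[of _ "Suc i"]) (simp add: mult_ac)
  qed
  moreover obtain k where "\<rho> ^ k < \<epsilon>" using real_arch_pow_inv[OF assms(7) \<rho>1] by blast
  ultimately obtain L where "norm (?P L) \<le> \<rho> ^ k * real (g ^ L)" by blast
  also have "\<dots> \<le> \<epsilon> * real (g ^ L)" using \<open>\<rho> ^ k < \<epsilon>\<close> by (intro mult_right_mono) simp_all
  finally show ?thesis by blast
qed

text \<open>For the least \<open>K\<close> with \<open>\<alpha> ^ (g ^ K) = 1\<close>, the factor at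
  position \<open>K - 1\<close> is the geometric sum of a nontrivial \<open>g\<close>-th root of
  unity, which vanishes. \<open>K\<close> is positive because
  \<open>\<alpha> \<noteq> 1\<close>.\<close>

lemma block_sum_eq_0_if_power_eventually_1:
  assumes "g \<ge> 2" and "\<alpha> \<noteq> 1" and "\<alpha> ^ (g ^ M) = 1"
  shows "\<exists>L. (\<Sum>n<g ^ L. digit_char g \<alpha> 1 n) = 0"
proof -
  define K where "K = (LEAST M. \<alpha> ^ (g ^ M) = 1)"
  have K: "\<alpha> ^ (g ^ K) = 1" unfolding K_def by (rule LeastI[of _ M]) (rule assms(3))
  then obtain J where J: "K = Suc J" using assms(2) by (cases K) auto
  have ne: "\<alpha> ^ (g ^ J) \<noteq> 1" using not_less_Least[of J "\<lambda>M. \<alpha> ^ (g ^ M) = 1"] J K_def by auto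
  have "(\<alpha> ^ (g ^ J)) ^ g = 1" using K by (simp add: J mult.commute flip: power_mult)
  then have "(\<Sum>d<g. (\<alpha> ^ (g ^ J)) ^ d) = 0" using geometric_sum[OF ne, of g] by simp
  then have "(\<Sum>n<g ^ K. digit_char g \<alpha> 1 n) = 0"
    unfolding J sum_digit_char_power_Suc[OF assms(1)] by simp
  then show ?thesis by blast
qed

lemma small_block_sum:
  assumes "g \<ge> 2" and "a \<ge> 1" and "a' \<ge> 1" and "\<alpha> ^ a = 1" and "\<beta> ^ a' = 1"
    and "\<not> (\<alpha> = 1 \<and> \<beta> = 1)" and n0: "a dvd n0" "[digit_sum g n0 = 1] (mod a')" and "\<epsilon> > 0"
  shows "\<exists>L. norm (\<Sum>n<g ^ L. digit_char g \<alpha> \<beta> n) \<le> \<epsilon> * real (g ^ L)"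
proof (cases "\<exists>M. \<forall>i\<ge>M. \<alpha> ^ (g ^ i) * \<beta> = 1")
  case False
  then show ?thesis
    using assms by (intro small_block_sum_if_frequently_nontrivial[of g a a']) auto
next
  case True
  then obtain M where M: "\<And>i. i \<ge> M \<Longrightarrow> \<alpha> ^ (g ^ i) * \<beta> = 1" by blast
  \<comment> \<open>Passing to \<open>\<alpha> ^ (g ^ M)\<close> discards the first \<open>M\<close>
    positions, so only trivial factors remain. As \<open>a\<close> divides \<open>n0\<close>, the
    value reduces to \<open>\<beta> ^ digit_sum g n0\<close>, which is \<beta>.\<close>
  have "digit_char g (\<alpha> ^ (g ^ M)) \<beta> n0 = 1"
    using M[of "M + i" for i]
    by (intro digit_char_eq_1[OF assms(1)]) (simp add: power_add flip: power_mult)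
  moreover have "(\<alpha> ^ (g ^ M)) ^ n0 = 1"
    using n0(1) assms(4) by (metis dvd_def mult.commute power_mult power_one)
  ultimately have "\<beta> = 1"
    using power_cong_root_unity[OF assms(5) n0(2)] by (simp add: digit_char_def)
  then obtain L where "(\<Sum>n<g ^ L. digit_char g \<alpha> \<beta> n) = 0"
    using block_sum_eq_0_if_power_eventually_1[OF assms(1), of \<alpha> M] M[of M] assms(6) by auto
  then show ?thesis using assms(9) by (intro exI[of _ L]) simp
qed

section \<open>Vanishing mean values\<close>

lemma tendsto_0_if_sublinear:
  fixes F :: "nat \<Rightarrow> 'a::real_normed_field"
  assumes "\<And>\<epsilon>. \<epsilon> > 0 \<Longrightarrow> \<exists>K. \<forall>N. norm (F N) \<le> \<epsilon> * real N + K"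
  shows "(\<lambda>N. F N / of_nat N) \<longlonglongrightarrow> 0"
proof (rule LIMSEQ_I)
  fix e :: real
  assume e: "e > 0"
  \<comment> \<open>Half of \<open>e\<close> serves the linear term, the other half absorbs
    \<open>K\<close> for large \<open>n\<close>.\<close>
  obtain K where K: "\<And>N. norm (F N) \<le> e / 2 * real N + K" using assms[of "e / 2"] e by auto
  obtain N0 where N0: "real N0 > 2 * K / e" using reals_Archimedean2 by blast
  show "\<exists>no. \<forall>n\<ge>no. norm (F n / of_nat n - 0) < e"
  proof (intro exI allI impI)
    fix n
    assume n: "n \<ge> Suc N0"
    then have "2 * K / e < real n" using N0 by linarith
    then have "K < e / 2 * real n" using e by (simp add: field_simps)
    then have "norm (F n) < e * real n" using K[of n] by linarith
    then show "norm (F n / of_nat n - 0) < e"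
      using n by (simp add: norm_divide divide_less_eq)
  qed
qed

lemma digit_char_mean_tendsto_0:
  assumes "g \<ge> 2" and "a \<ge> 1" and "a' \<ge> 1" and "\<alpha> ^ a = 1" and "\<beta> ^ a' = 1"
    and "\<not> (\<alpha> = 1 \<and> \<beta> = 1)" and n0: "a dvd n0" "[digit_sum g n0 = 1] (mod a')"
  shows "(\<lambda>N. (\<Sum>n=1..N. digit_char g \<alpha> \<beta> n) / of_nat N) \<longlonglongrightarrow> 0"
proof (rule tendsto_0_if_sublinear)
  let ?f = "digit_char g \<alpha> \<beta>"
  fix \<epsilon> :: real
  assume \<epsilon>: "\<epsilon> > 0"
  obtain L where L: "norm (\<Sum>n<g ^ L. ?f n) \<le> \<epsilon> * real (g ^ L)"
    using small_block_sum[OF assms \<epsilon>] by blast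
  have nrm: "norm \<alpha> = 1" "norm \<beta> = 1" using norm_root_unity assms by blast+
  \<comment> \<open>Shifting the range from \<open>n < N\<close> to \<open>1..N\<close> adds the
    term at \<open>N\<close> and removes that at 0, both of modulus 1; hence the summand 2.\<close>
  have "norm (\<Sum>n=1..N. ?f n) \<le> \<epsilon> * real N + (real (g ^ L) + 2)" for N
  proof -
    have "(\<Sum>n<Suc N. ?f n) = ?f 0 + (\<Sum>n=1..N. ?f n)"
      by (simp only: sum.lessThan_Suc_shift sum.atLeast1_atMost_eq One_nat_def)
    then have "(\<Sum>n=1..N. ?f n) = (\<Sum>n<N. ?f n) + (?f N - ?f 0)" by (simp add: algebra_simps)
    moreover have "norm (?f N - ?f 0) \<le> 2"
      using norm_triangle_ineq4[of "?f N" "?f 0"] norm_digit_char[OF nrm, of g] by simp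
    moreover have "norm (\<Sum>n<N. ?f n) \<le> \<epsilon> * real N + real (g ^ L)"
      using norm_sum_digit_char_le[OF assms(1) nrm L] \<epsilon> by simp
    ultimately show ?thesis
      using norm_triangle_ineq[of "\<Sum>n<N. ?f n" "?f N - ?f 0"] by simp
  qed
  then show "\<exists>K. \<forall>N. norm (\<Sum>n=1..N. ?f n) \<le> \<epsilon> * real N + K" by blast
qed

section \<open>Orthogonality and the count\<close>

lemma sum_powers_roots_unity:
  assumes "a \<ge> 1"
  shows "(\<Sum>z | z ^ a = 1. z ^ n) = (if a dvd n then of_nat a else (0::complex))"
proof (cases "a dvd n")
  case True
  then have "(\<Sum>z::complex | z ^ a = 1. z ^ n) = (\<Sum>z::complex | z ^ a = 1. 1)"
    by (intro sum.cong) (auto simp: power_mult)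
  then show ?thesis using True assms card_roots_unity_eq[of a] by simp
next
  case False
  let ?c = "\<lambda>k. cis (2 * pi * real k / real a)"
  have bij: "bij_betw ?c {..<a} {z. z ^ a = 1}" using assms by (intro bij_betw_roots_unity) simp
  let ?w = "?c 1"
  have w: "?w ^ a = 1" using assms by (simp add: DeMoivre)
  \<comment> \<open>\<open>?w\<close> is a primitive root: its powers with exponents below
    \<open>a\<close> are distinct.\<close>
  have "?w ^ n \<noteq> 1"
  proof
    assume "?w ^ n = 1"
    have "[n mod a = n] (mod a)" by (simp add: cong_def)
    from power_cong_root_unity[OF w this] have "?c (n mod a) = ?c 0"
      using \<open>?w ^ n = 1\<close> by (simp add: DeMoivre mult_ac)
    moreover have "n mod a \<in> {..<a}" "0 \<in> {..<a}" using assms by auto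
    ultimately have "n mod a = 0" using bij_betw_imp_inj_on[OF bij] by (meson inj_onD)
    with False show False by auto
  qed
  \<comment> \<open>Multiplication by \<open>?w\<close> permutes the roots, so the sum equals
    \<open>?w ^ n\<close> times itself and must vanish.\<close>
  moreover have "(\<Sum>z | z ^ a = 1. z ^ n) = (\<Sum>z | z ^ a = 1. (?w * z) ^ n)"
    using w by (intro sum.reindex_bij_witness[of _ "\<lambda>z. ?w * z" "\<lambda>z. z / ?w"])
      (auto simp: power_mult_distrib power_divide)
  ultimately show ?thesis using False
    by (simp add: power_mult_distrib flip: sum_distrib_left)
qed

text \<open>Shifting by a natural representative of \<open>- b\<close> turns the congruence into
  divisibility in the naturals, so that orthogonality applies without negative powers.\<close>

lemma cong_int_iff_dvd_add:
  assumes "a \<ge> 1"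
  shows "[int n = b] (mod int a) \<longleftrightarrow> a dvd n + nat ((- b) mod int a)"
proof -
  have "a dvd n + nat ((- b) mod int a) \<longleftrightarrow> int a dvd int n + (- b) mod int a"
    using assms by (simp flip: int_dvd_int_iff)
  also have "\<dots> \<longleftrightarrow> int a dvd int n + - b"
    by (metis dvd_eq_mod_eq_0 mod_add_right_eq)
  finally show ?thesis by (simp add: cong_iff_dvd_diff)
qed

text \<open>Orthogonality in both conditions writes \<open>a * a'\<close> times the count as a
  weighted sum over pairs of roots of unity. Only the pair (1, 1), with weight 1, has a nonzero
  mean.\<close>

lemma tendsto_density:
  fixes g a a' :: nat and b b' :: int
  assumes "g \<ge> 2" and "a \<ge> 1" and "a' \<ge> 1"
    and n0: "a dvd n0" "[digit_sum g n0 = 1] (mod a')"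
  shows "(\<lambda>N. real (card {n. 1 \<le> n \<and> n \<le> N \<and>
      [int n = b] (mod int a) \<and> [int (digit_sum g n) = b'] (mod int a')}) / real N)
    \<longlonglongrightarrow> 1 / (real a * real a')"
proof -
  define R where "R k = {z::complex. z ^ k = 1}" for k :: nat
  define c c' where "c = nat ((- b) mod int a)" and "c' = nat ((- b') mod int a')"
  define A where "A N = {n. 1 \<le> n \<and> n \<le> N \<and>
      [int n = b] (mod int a) \<and> [int (digit_sum g n) = b'] (mod int a')}" for N
  let ?f = "digit_char g"
  have fin: "finite (R a)" "finite (R a')"
    unfolding R_def using assms by (simp_all add: finite_roots_unity)
  have count: "of_nat a * of_nat a' * complex_of_nat (card (A N)) =
      (\<Sum>\<alpha>\<in>R a. \<Sum>\<beta>\<in>R a'. \<alpha> ^ c * \<beta> ^ c' * (\<Sum>n=1..N. ?f \<alpha> \<beta> n))" for N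
  proof -
    have "A N = {n \<in> {1..N}. a dvd n + c \<and> a' dvd digit_sum g n + c'}"
      using assms by (auto simp: A_def c_def c'_def cong_int_iff_dvd_add)
    then have "of_nat a * of_nat a' * complex_of_nat (card (A N)) =
        (\<Sum>n=1..N. if a dvd n + c \<and> a' dvd digit_sum g n + c' then of_nat a * of_nat a' else 0)"
      by (simp add: sum.inter_filter[symmetric])
    also have "\<dots> = (\<Sum>n=1..N. (\<Sum>\<alpha>\<in>R a. \<alpha> ^ (n + c)) * (\<Sum>\<beta>\<in>R a'. \<beta> ^ (digit_sum g n + c')))"
      unfolding R_def using assms by (intro sum.cong) (simp_all add: sum_powers_roots_unity)
    also have "\<dots> = (\<Sum>n=1..N. \<Sum>\<alpha>\<in>R a. \<Sum>\<beta>\<in>R a'. \<alpha> ^ c * \<beta> ^ c' * ?f \<alpha> \<beta> n)"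
      by (simp add: sum_product digit_char_def power_add mult_ac)
    also have "\<dots> = (\<Sum>\<alpha>\<in>R a. \<Sum>n=1..N. \<Sum>\<beta>\<in>R a'. \<alpha> ^ c * \<beta> ^ c' * ?f \<alpha> \<beta> n)"
      by (rule sum.swap)
    also have "\<dots> = (\<Sum>\<alpha>\<in>R a. \<Sum>\<beta>\<in>R a'. \<Sum>n=1..N. \<alpha> ^ c * \<beta> ^ c' * ?f \<alpha> \<beta> n)"
      by (intro sum.cong refl sum.swap)
    finally show ?thesis by (simp add: sum_distrib_left)
  qed
  \<comment> \<open>The nested conditionals let the two sums over roots collapse one after the
    other.\<close>
  have mean: "(\<lambda>N. (\<Sum>n=1..N. ?f \<alpha> \<beta> n) / of_nat N) \<longlonglongrightarrow>
      (if \<alpha> = 1 then if \<beta> = 1 then 1 else 0 else 0)" if "\<alpha> \<in> R a" "\<beta> \<in> R a'" for \<alpha> \<beta>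
  proof (cases "\<alpha> = 1 \<and> \<beta> = 1")
    case True
    have "\<forall>\<^sub>F N in sequentially. (\<Sum>n=1..N. ?f \<alpha> \<beta> n) / of_nat N = 1"
      using eventually_gt_at_top[of 0] by eventually_elim (simp add: True digit_char_def)
    then show ?thesis using True by (simp add: tendsto_eventually)
  next
    case False
    then show ?thesis
      using digit_char_mean_tendsto_0[OF assms(1-3) _ _ False n0] that by (auto simp: R_def)
  qed
  have "(\<lambda>N. \<Sum>\<alpha>\<in>R a. \<Sum>\<beta>\<in>R a'. \<alpha> ^ c * \<beta> ^ c' * ((\<Sum>n=1..N. ?f \<alpha> \<beta> n) / of_nat N)) \<longlonglongrightarrow>
      (\<Sum>\<alpha>\<in>R a. \<Sum>\<beta>\<in>R a'. \<alpha> ^ c * \<beta> ^ c' * (if \<alpha> = 1 then if \<beta> = 1 then 1 else 0 else 0))"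
    by (intro tendsto_sum tendsto_mult tendsto_const mean)
  also have "(\<Sum>\<alpha>\<in>R a. \<Sum>\<beta>\<in>R a'. \<alpha> ^ c * \<beta> ^ c' * (if \<alpha> = 1 then if \<beta> = 1 then 1 else 0 else 0)) =
      (\<Sum>\<alpha>\<in>R a. if \<alpha> = 1 then (\<Sum>\<beta>\<in>R a'. if \<beta> = 1 then 1 else 0) else 0)"
    by (intro sum.cong refl) (auto intro!: sum.cong)
  also have "\<dots> = 1" using fin by (simp add: R_def)
  also have "(\<lambda>N. \<Sum>\<alpha>\<in>R a. \<Sum>\<beta>\<in>R a'. \<alpha> ^ c * \<beta> ^ c' * ((\<Sum>n=1..N. ?f \<alpha> \<beta> n) / of_nat N)) =
      (\<lambda>N. of_real (real a * real a' * (real (card (A N)) / real N)))"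
  proof
    fix N
    have "(\<Sum>\<alpha>\<in>R a. \<Sum>\<beta>\<in>R a'. \<alpha> ^ c * \<beta> ^ c' * ((\<Sum>n=1..N. ?f \<alpha> \<beta> n) / of_nat N)) =
        (of_nat a * of_nat a' * of_nat (card (A N))) / of_nat N"
      unfolding count
      by (simp only: sum_divide_distrib[of _ "R a"] sum_divide_distrib[of _ "R a'"] times_divide_eq_right)
    then show "(\<Sum>\<alpha>\<in>R a. \<Sum>\<beta>\<in>R a'. \<alpha> ^ c * \<beta> ^ c' * ((\<Sum>n=1..N. ?f \<alpha> \<beta> n) / of_nat N)) =
        of_real (real a * real a' * (real (card (A N)) / real N))"
      by simp
  qed
  finally have "(\<lambda>N. real a * real a' * (real (card (A N)) / real N)) \<longlonglongrightarrow> 1"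
    using tendsto_of_real_iff[where 'a = complex and c = 1] by (metis of_real_1)
  then have "(\<lambda>N. (real a * real a' * (real (card (A N)) / real N)) / (real a * real a')) \<longlonglongrightarrow>
      1 / (real a * real a')"
    using assms by (intro tendsto_divide tendsto_const) simp_all
  then show ?thesis using assms unfolding A_def by simp
qed

section \<open>Equivalence of equidistribution and the existence of a suitable
  \<open>n\<close>\<close>

theorem theorem2:
  fixes g a a' :: nat
  assumes "g \<ge> 2" and "a \<ge> 1" and "a' \<ge> 1"
  shows "(\<forall>b b' :: int.
            (\<lambda>N :: nat.
               real (card {n :: nat. 1 \<le> n \<and> n \<le> N \<and>
                        [int n = b] (mod int a) \<and> [int (digit_sum g n) = b'] (mod int a')})
               / real N)
            \<longlonglongrightarrow> 1 / (real a * real a'))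
         \<longleftrightarrow> (\<exists>n :: nat. 1 \<le> n \<and>
                [int n = 0] (mod int a) \<and> [int (digit_sum g n) = 1] (mod int a'))"
    (is "?equidistributed \<longleftrightarrow> ?ex")
proof
  assume lim: ?equidistributed
  show ?ex
  proof (rule ccontr)
    \<comment> \<open>The counting set for \<open>b = 0\<close> and \<open>b' = 1\<close> would be
      empty for every \<open>N\<close>, so its density would be 0 instead of a positive
      number.\<close>
    assume "\<not> ?ex"
    then have empty: "{n. 1 \<le> n \<and> n \<le> N \<and> [int n = 0] (mod int a) \<and>
        [int (digit_sum g n) = 1] (mod int a')} = {}" for N
      by blast
    have "(\<lambda>N :: nat. 0 :: real) \<longlonglongrightarrow> 1 / (real a * real a')"
      using lim[rule_format, of 0 1] unfolding empty by simp
    then show False using assms by (simp add: LIMSEQ_const_iff)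
  qed
next
  assume ?ex
  then obtain n0 where "[int n0 = int 0] (mod int a)" "[int (digit_sum g n0) = int 1] (mod int a')"
    by auto
  then have "a dvd n0" "[digit_sum g n0 = 1] (mod a')"
    unfolding cong_int_iff by (simp_all add: cong_0_iff)
  then show ?equidistributed using tendsto_density[OF assms] by blast
qed

end
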